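(* Let $(G,X)$ be a $G$-system with $G$ a discrete infinite amenable group and $(X,d)$ a compact metric space, and let $\mathcal{F}$ be a F{\o}lner net in $G$. If $X$ is S-generic (i.e. there is $x\in X$ with $\mathcal{C}_{\mathcal{F}}(x)=X$) and $(G,X)$ is not minimal, then $(G,X)$ is point transitive and there is an $\epsilon>0$ such that for every $\hat{x}\in X$ there exists a dense subset $S_\epsilon(\hat{x})$ of $X$ such that for each $y\in S_\epsilon(\hat{x})$ there is a sequence $\{t_n\}_{n=1}^\infty$ in $G$ with $\lim_{n\to+\infty}d(t_n\hat{x},t_ny)\geq\epsilon$.
   Context: A $G$-system $(G,X)$: $G$ is a discrete infinite amenable group with identity $e$, $(X,d)$ is a compact metric space, and $G$ acts on $X$ from the left by continuous transformations ($ex=x$, $(gf)x=g(fx)$). $(G,X)$ is minimal if every orbit $Gx$ is dense in $X$; it is point transitive if some orbit $Gy$ is dense in $X$. A (left) F{\o}lner net in $G$ is a net $\mathcal{F}=\{F_n\}_{n\in D}$ of (nonempty) finite subsets of $G$ with $\lim_{n\in D}|gF_n\vartriangle F_n|/|F_n|=0$ for all $g\in G$. For $A\subseteq G$, $\overline{d}_{\mathcal{F}}(A)=\sup\{\alpha \mid \forall m\in D\ \exists n\ge m:\ |A\cap F_n|/|F_n|\ge\alpha\}$ and $\underline{d}_{\mathcal{F}}(A)=\sup\{\alpha \mid \exists m\in D\ \forall n\ge m:\ |A\cap F_n|/|F_n|\ge\alpha\}$; if they coincide the common value is $d_{\mathcal{F}}(A)$. A closed set $C\subseteq X$ is an $\mathcal{F}$-center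 of attraction of $x$ if $d_{\mathcal{F}}(\{g\in G\mid gx\in B_\epsilon(C)\})=1$ for all $\epsilon>0$, where $B_\epsilon(C)$ is the $\epsilon$-neighborhood of $C$. The minimal one (no proper subset of which is an $\mathcal{F}$-center of attraction of $x$), which exists and is unique, is denoted $\mathcal{C}_{\mathcal{F}}(x)$. *)

theory Defs
  imports "HOL-Analysis.Analysis" "HOL-Algebra.Group_Action"
begin

text \<open>
  Amenability in von Neumann's sense: there is a finitely additive, left-invariant
  probability measure defined on all subsets of the group.
\<close>

definition amenable_group :: "('g, 'b) monoid_scheme \<Rightarrow> bool" where
  "amenable_group G \<longleftrightarrow> group G \<and>
     (\<exists>\<mu> :: 'g set \<Rightarrow> real.
        \<mu> (carrier G) = 1 \<and>
        (\<forall>A. A \<subseteq> carrier G \<longrightarrow> 0 \<le> \<mu> A) \<and>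
        (\<forall>A B. A \<subseteq> carrier G \<longrightarrow> B \<subseteq> carrier G \<longrightarrow> A \<inter> B = {} \<longrightarrow>
           \<mu> (A \<union> B) = \<mu> A + \<mu> B) \<and>
        (\<forall>g\<in>carrier G. \<forall>A. A \<subseteq> carrier G \<longrightarrow> \<mu> (g <#\<^bsub>G\<^esub> A) = \<mu> A))"

text \<open>
  The space is a compact subset \<open>X\<close> of a metric type, with the induced metric.
  \<^locale>\<open>group_action\<close> is the left action \<open>g x = \<phi> g x\<close>; it also makes each \<open>\<phi> g\<close>
  equal to \<open>undefined\<close> outside \<open>X\<close>, which carries no mathematical content.
\<close>

locale G_system = group_action G X \<phi>
  for G :: "('g, 'b) monoid_scheme" (structure)
    and X :: "'x::metric_space set"
    and \<phi> :: "'g \<Rightarrow> 'x \<Rightarrow> 'x" +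
  assumes infinite_group: "infinite (carrier G)"
    and amenable: "amenable_group G"
    and compact_space: "compact X"
    and continuous_action: "g \<in> carrier G \<Longrightarrow> continuous_on X (\<phi> g)"

definition dense_in :: "'x::metric_space set \<Rightarrow> 'x set \<Rightarrow> bool" where
  "dense_in X S \<longleftrightarrow> S \<subseteq> X \<and> X \<subseteq> closure S"

definition minimal_system ::
  "('g, 'b) monoid_scheme \<Rightarrow> 'x::metric_space set \<Rightarrow> ('g \<Rightarrow> 'x \<Rightarrow> 'x) \<Rightarrow> bool" where
  "minimal_system G X \<phi> \<longleftrightarrow> (\<forall>x\<in>X. dense_in X (orbit G \<phi> x))"

definition point_transitive ::
  "('g, 'b) monoid_scheme \<Rightarrow> 'x::metric_space set \<Rightarrow> ('g \<Rightarrow> 'x \<Rightarrow> 'x) \<Rightarrow> bool" where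
  "point_transitive G X \<phi> \<longleftrightarrow> (\<exists>y\<in>X. dense_in X (orbit G \<phi> y))"

text \<open>Here \<open>(m, n) \<in> r\<close> reads \<open>m \<le> n\<close>; antisymmetry is not required.\<close>

definition directed_set :: "'d set \<Rightarrow> 'd rel \<Rightarrow> bool" where
  "directed_set D r \<longleftrightarrow> D \<noteq> {} \<and> preorder_on D r \<and>
     (\<forall>m\<in>D. \<forall>n\<in>D. \<exists>k\<in>D. (m, k) \<in> r \<and> (n, k) \<in> r)"

text \<open>Convergence along this filter is Moore-Smith convergence of nets indexed by \<open>D\<close>.\<close>

definition net_filter :: "'d set \<Rightarrow> 'd rel \<Rightarrow> 'd filter" where
  "net_filter D r = (INF m\<in>D. principal {n\<in>D. (m, n) \<in> r})"

definition folner_net ::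
  "('g, 'b) monoid_scheme \<Rightarrow> 'd set \<Rightarrow> 'd rel \<Rightarrow> ('d \<Rightarrow> 'g set) \<Rightarrow> bool" where
  "folner_net G D r F \<longleftrightarrow> directed_set D r \<and>
     (\<forall>n\<in>D. F n \<subseteq> carrier G \<and> finite (F n) \<and> F n \<noteq> {}) \<and>
     (\<forall>g\<in>carrier G.
        ((\<lambda>n. real (card (sym_diff (g <#\<^bsub>G\<^esub> F n) (F n))) / real (card (F n)))
           \<longlongrightarrow> 0) (net_filter D r))"

definition upper_density :: "'d set \<Rightarrow> 'd rel \<Rightarrow> ('d \<Rightarrow> 'g set) \<Rightarrow> 'g set \<Rightarrow> real" where
  "upper_density D r F A = Sup {\<alpha>. \<forall>m\<in>D. \<exists>n\<in>D. (m, n) \<in> r \<and>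
     real (card (A \<inter> F n)) / real (card (F n)) \<ge> \<alpha>}"

definition lower_density :: "'d set \<Rightarrow> 'd rel \<Rightarrow> ('d \<Rightarrow> 'g set) \<Rightarrow> 'g set \<Rightarrow> real" where
  "lower_density D r F A = Sup {\<alpha>. \<exists>m\<in>D. \<forall>n\<in>D. (m, n) \<in> r \<longrightarrow>
     real (card (A \<inter> F n)) / real (card (F n)) \<ge> \<alpha>}"

definition has_density ::
  "'d set \<Rightarrow> 'd rel \<Rightarrow> ('d \<Rightarrow> 'g set) \<Rightarrow> 'g set \<Rightarrow> real \<Rightarrow> bool" where
  "has_density D r F A a \<longleftrightarrow> upper_density D r F A = a \<and> lower_density D r F A = a"

text \<open>
  Defined through points of \<open>C\<close>, since \<^term>\<open>infdist y {} = 0\<close> would make the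
  neighborhood of the empty set all of \<open>X\<close>.
\<close>

definition nbhd :: "'x::metric_space set \<Rightarrow> real \<Rightarrow> 'x set \<Rightarrow> 'x set" where
  "nbhd X \<epsilon> C = {y\<in>X. \<exists>c\<in>C. dist y c < \<epsilon>}"

definition center_of_attraction ::
  "('g, 'b) monoid_scheme \<Rightarrow> 'x::metric_space set \<Rightarrow> ('g \<Rightarrow> 'x \<Rightarrow> 'x) \<Rightarrow>
   'd set \<Rightarrow> 'd rel \<Rightarrow> ('d \<Rightarrow> 'g set) \<Rightarrow> 'x \<Rightarrow> 'x set \<Rightarrow> bool" where
  "center_of_attraction G X \<phi> D r F x C \<longleftrightarrow> closedin (top_of_set X) C \<and>
     (\<forall>\<epsilon>>0. has_density D r F {g \<in> carrier G. \<phi> g x \<in> nbhd X \<epsilon> C} 1)"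

definition minimal_center ::
  "('g, 'b) monoid_scheme \<Rightarrow> 'x::metric_space set \<Rightarrow> ('g \<Rightarrow> 'x \<Rightarrow> 'x) \<Rightarrow>
   'd set \<Rightarrow> 'd rel \<Rightarrow> ('d \<Rightarrow> 'g set) \<Rightarrow> 'x \<Rightarrow> 'x set" where
  "minimal_center G X \<phi> D r F x =
     (THE C. center_of_attraction G X \<phi> D r F x C \<and>
        (\<forall>C'. C' \<subset> C \<longrightarrow> \<not> center_of_attraction G X \<phi> D r F x C'))"

definition S_generic ::
  "('g, 'b) monoid_scheme \<Rightarrow> 'x::metric_space set \<Rightarrow> ('g \<Rightarrow> 'x \<Rightarrow> 'x) \<Rightarrow>
   'd set \<Rightarrow> 'd rel \<Rightarrow> ('d \<Rightarrow> 'g set) \<Rightarrow> bool" where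
  "S_generic G X \<phi> D r F \<longleftrightarrow> (\<exists>x\<in>X. minimal_center G X \<phi> D r F x = X)"

end

theory Submission
  imports Defs
begin

text \<open>
  The minimal center of \<open>x\<close> is the set of points all of whose neighborhoods are visited by
  the orbit of \<open>x\<close> with positive upper density. So if it is all of \<open>X\<close>, the orbit of \<open>x\<close> is dense,
  and the set \<open>A\<close> of visit times to any nonempty open set has the property that finitely many
  translates of \<open>A A\<inverse>\<close> cover the group: disjoint translates of \<open>A\<close> have the same density along
  a common subnet, so there are only finitely many of them.

  Let the orbit of \<open>z\<close> stay at distance \<open>4\<delta>\<close> from \<open>w\<close>, and suppose that some nonempty open set
  had all its translates of diameter at most \<open>\<delta>\<close>. A translate \<open>U\<close> of it contains a point \<open>x'\<close> of
  the orbit of \<open>x\<close> near \<open>w\<close>. For \<open>A\<close> the visit times of \<open>x\<close> to a small ball around \<open>x'\<close>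
  in \<open>U\<close>, elements of \<open>A A\<inverse>\<close> move \<open>x'\<close> to a
  point still near \<open>w\<close>. But \<open>x'\<close> can be moved so close to \<open>z\<close> that the finitely many translations
  leading back into \<open>A A\<inverse>\<close> keep it near the orbit of \<open>z\<close>, which is far from \<open>w\<close>. Hence the system
  is sensitive, and a ball containing two points that \<open>t\<close> separates by more than \<open>\<delta>\<close> contains one
  that \<open>t\<close> separates from \<open>xhat\<close> by more than \<open>\<delta>/2\<close>; constant sequences suffice.
\<close>

section \<open>Nets, densities and sets of density zero\<close>

text \<open>The tails form a filter base: directedness gives an index later than any two, and
  transitivity puts its tail inside both of theirs.\<close>

lemma eventually_net_filter:
  assumes "directed_set D r"
  shows "eventually P (net_filter D r) \<longleftrightarrow> (\<exists>m\<in>D. \<forall>n\<in>D. (m, n) \<in> r \<longrightarrow> P n)"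
proof -
  have tr: "trans r" and ne: "D \<noteq> {}"
    using assms unfolding directed_set_def preorder_on_def by auto
  have "\<exists>k\<in>D. {n\<in>D. (k, n) \<in> r} \<subseteq> {n\<in>D. (a, n) \<in> r} \<inter> {n\<in>D. (b, n) \<in> r}"
    if ab: "a \<in> D" "b \<in> D" for a b
  proof -
    obtain k where "k \<in> D" "(a, k) \<in> r" "(b, k) \<in> r"
      using assms ab unfolding directed_set_def by blast
    then show ?thesis using transD[OF tr] by blast
  qed
  then have "eventually P (net_filter D r) \<longleftrightarrow>
      (\<exists>m\<in>D. eventually P (principal {n\<in>D. (m, n) \<in> r}))"
    unfolding net_filter_def using ne
    by (intro eventually_INF_base) (auto simp: principal_le_iff)
  then show ?thesis
    by (auto simp: eventually_principal)
qed

text \<open>Density zero is phrased as a limit rather than a supremum, so that sandwiching and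
  finite sums of limits apply directly.\<close>

definition negligible_along :: "'d set \<Rightarrow> 'd rel \<Rightarrow> ('d \<Rightarrow> 'g set) \<Rightarrow> 'g set \<Rightarrow> bool" where
  "negligible_along D r F A \<longleftrightarrow>
     ((\<lambda>n. real (card (A \<inter> F n)) / real (card (F n))) \<longlongrightarrow> 0) (net_filter D r)"

text \<open>Meant for the down-closed threshold sets in \<open>lower_density\<close> and
  \<open>upper_density\<close>; the threshold 1 itself need not be attained.\<close>

lemma Sup_eq_1_iff:
  fixes S :: "real set"
  assumes "S \<noteq> {}" "S \<subseteq> {..1}"
    and down: "\<And>a b. a \<in> S \<Longrightarrow> b \<le> a \<Longrightarrow> b \<in> S"
  shows "Sup S = 1 \<longleftrightarrow> {..<1} \<subseteq> S"
proof
  have bdd: "bdd_above S" using assms(2) by auto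
  show "{..<1} \<subseteq> S" if "Sup S = 1"
  proof
    fix b :: real assume "b \<in> {..<1}"
    then have "b < Sup S" using that by simp
    then obtain a where "a \<in> S" "b < a" using less_cSup_iff[OF assms(1) bdd] by blast
    then show "b \<in> S" using down by auto
  qed
  show "Sup S = 1" if "{..<1} \<subseteq> S"
  proof (rule antisym)
    show "Sup S \<le> 1" using assms by (intro cSup_least) auto
    show "1 \<le> Sup S"
    proof (rule dense_le)
      fix b :: real assume "b < 1"
      then have "b \<in> S" using that by auto
      then show "b \<le> Sup S" using bdd by (rule cSup_upper)
    qed
  qed
qed

context
  fixes G :: "('g, 'b) monoid_scheme" and D :: "'d set" and r :: "'d rel" and F :: "'d \<Rightarrow> 'g set"
  assumes folner: "folner_net G D r F"
begin

lemma directed: "directed_set D r"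
  using folner unfolding folner_net_def by blast

lemma folner_sets: "n \<in> D \<Longrightarrow> F n \<subseteq> carrier G" "n \<in> D \<Longrightarrow> finite (F n)"
    "n \<in> D \<Longrightarrow> card (F n) > 0"
  using folner unfolding folner_net_def by (auto simp: card_gt_0_iff)

lemma eventually_in_index: "eventually (\<lambda>n. n \<in> D) (net_filter D r)"
  using directed by (auto simp: eventually_net_filter directed_set_def)

text \<open>By directedness every lower threshold is an upper one, and no upper one exceeds 1, so
  only the lower density matters. Its thresholds are eventual bounds, which pass to the complement
  because the two frequencies add up to 1.\<close>

lemma has_density_1_iff:
  assumes "A \<subseteq> carrier G"
  shows "has_density D r F A 1 \<longleftrightarrow> negligible_along D r F (carrier G - A)"
proof -
  let ?q = "\<lambda>n. real (card (A \<inter> F n)) / real (card (F n))"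
  let ?c = "\<lambda>n. real (card ((carrier G - A) \<inter> F n)) / real (card (F n))"
  let ?U = "{\<alpha>. \<forall>m\<in>D. \<exists>n\<in>D. (m, n) \<in> r \<and> ?q n \<ge> \<alpha>}"
  let ?L = "{\<alpha>. \<exists>m\<in>D. \<forall>n\<in>D. (m, n) \<in> r \<longrightarrow> ?q n \<ge> \<alpha>}"
  have refl: "(m, m) \<in> r" if "m \<in> D" for m
    using directed that unfolding directed_set_def preorder_on_def refl_on_def by blast
  have ne: "D \<noteq> {}" using directed unfolding directed_set_def by blast
  have dir: "\<exists>k\<in>D. (m, k) \<in> r \<and> (n, k) \<in> r" if "m \<in> D" "n \<in> D" for m n
    using directed that unfolding directed_set_def by blast
  have q1: "?q n \<le> 1" if "n \<in> D" for n
    using folner_sets[OF that] by (simp add: card_mono)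
  have qc: "?c n = 1 - ?q n" if "n \<in> D" for n
  proof -
    have "F n = (A \<inter> F n) \<union> ((carrier G - A) \<inter> F n)" using folner_sets(1)[OF that] by auto
    then have "card (F n) = card (A \<inter> F n) + card ((carrier G - A) \<inter> F n)"
      using folner_sets(2)[OF that]
      by (metis Diff_Int_distrib2 Diff_disjoint Int_assoc card_Un_disjoint finite_Int
          inf_commute inf_bot_left)
    then have "real (card (F n)) = real (card (A \<inter> F n)) + real (card ((carrier G - A) \<inter> F n))"
      by linarith
    then show ?thesis using folner_sets(3)[OF that] by (simp add: field_simps)
  qed
  have LU: "?L \<subseteq> ?U"
  proof
    fix a assume "a \<in> ?L"
    then obtain m where m: "m \<in> D" "\<And>n. n \<in> D \<Longrightarrow> (m, n) \<in> r \<Longrightarrow> a \<le> ?q n" by blast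
    have "\<exists>n\<in>D. (m', n) \<in> r \<and> a \<le> ?q n" if "m' \<in> D" for m'
      using dir[OF m(1) that] m(2) by blast
    then show "a \<in> ?U" by blast
  qed
  have U1: "?U \<subseteq> {..1}"
  proof
    fix a assume "a \<in> ?U"
    then obtain n where "n \<in> D" "a \<le> ?q n" using ne by blast
    then show "a \<in> {..1}" using q1[of n] by simp
  qed
  have mono: "?q n \<ge> b" if "?q n \<ge> a" "b \<le> a" for a b n using that by linarith
  have "0 \<in> ?L" using ne by auto
  then have nes: "?L \<noteq> {}" "?U \<noteq> {}" using LU by blast+
  have L: "lower_density D r F A = 1 \<longleftrightarrow> {..<1} \<subseteq> ?L"
    unfolding lower_density_def using nes LU U1
    by (intro Sup_eq_1_iff) (blast, blast, use mono in blast)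
  have U: "upper_density D r F A = 1 \<longleftrightarrow> {..<1} \<subseteq> ?U"
    unfolding upper_density_def using nes U1
    by (intro Sup_eq_1_iff) (blast, blast, use mono in blast)
  have "has_density D r F A 1 \<longleftrightarrow> {..<1} \<subseteq> ?L"
    unfolding has_density_def L U using LU by blast
  also have "\<dots> \<longleftrightarrow> (\<forall>b<1. eventually (\<lambda>n. b \<le> ?q n) (net_filter D r))"
    unfolding eventually_net_filter[OF directed] by auto
  also have "\<dots> \<longleftrightarrow> (\<forall>e>0. eventually (\<lambda>n. dist (?c n) 0 < e) (net_filter D r))"
  proof (intro iffI allI impI)
    fix e :: real assume e: "e > 0" and *: "\<forall>b<1. eventually (\<lambda>n. b \<le> ?q n) (net_filter D r)"
    \<comment> \<open>Halving \<open>e\<close> turns a non-strict threshold into the strict bound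
      required by the limit.\<close>
    have "eventually (\<lambda>n. 1 - e/2 \<le> ?q n) (net_filter D r)" using * e by simp
    with eventually_in_index show "eventually (\<lambda>n. dist (?c n) 0 < e) (net_filter D r)"
    proof eventually_elim
      case (elim n)
      then have "\<bar>1 - ?q n\<bar> < e" using q1[of n] e by linarith
      then show ?case unfolding qc[OF elim(1)] by (simp add: dist_real_def)
    qed
  next
    fix b :: real
    assume b: "b < 1" and *: "\<forall>e>0. eventually (\<lambda>n. dist (?c n) 0 < e) (net_filter D r)"
    have "eventually (\<lambda>n. dist (?c n) 0 < 1 - b) (net_filter D r)" using * b by simp
    with eventually_in_index show "eventually (\<lambda>n. b \<le> ?q n) (net_filter D r)"
    proof eventually_elim
      case (elim n)
      then have "\<bar>1 - ?q n\<bar> < 1 - b" using qc[OF elim(1)] by (simp add: dist_real_def)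
      then show ?case by linarith
    qed
  qed
  finally show ?thesis unfolding negligible_along_def tendsto_iff .
qed

lemma negligible_along_empty: "negligible_along D r F {}"
  unfolding negligible_along_def by simp

lemma negligible_along_subset:
  assumes "negligible_along D r F B" "A \<subseteq> B"
  shows "negligible_along D r F A"
  unfolding negligible_along_def
proof (rule tendsto_sandwich[OF _ _ tendsto_const])
  show "((\<lambda>n. real (card (B \<inter> F n)) / real (card (F n))) \<longlongrightarrow> 0) (net_filter D r)"
    using assms(1) unfolding negligible_along_def .
  show "\<forall>\<^sub>F n in net_filter D r. 0 \<le> real (card (A \<inter> F n)) / real (card (F n))" by simp
  show "\<forall>\<^sub>F n in net_filter D r. real (card (A \<inter> F n)) / real (card (F n))
      \<le> real (card (B \<inter> F n)) / real (card (F n))"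
    using eventually_in_index
  proof eventually_elim
    case (elim n)
    have "card (A \<inter> F n) \<le> card (B \<inter> F n)"
      using folner_sets(2)[OF elim] assms(2) by (intro card_mono) auto
    then show ?case by (simp add: divide_right_mono)
  qed
qed

lemma negligible_along_UN:
  assumes "finite I" "\<And>i. i \<in> I \<Longrightarrow> negligible_along D r F (A i)"
  shows "negligible_along D r F (\<Union>i\<in>I. A i)"
  unfolding negligible_along_def
proof (rule tendsto_sandwich[OF _ _ tendsto_const])
  show "((\<lambda>n. \<Sum>i\<in>I. real (card (A i \<inter> F n)) / real (card (F n))) \<longlongrightarrow> 0) (net_filter D r)"
    using assms(2) unfolding negligible_along_def by (intro tendsto_null_sum)
  show "\<forall>\<^sub>F n in net_filter D r. 0 \<le> real (card ((\<Union>i\<in>I. A i) \<inter> F n)) / real (card (F n))"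
    by simp
  have "real (card ((\<Union>i\<in>I. A i) \<inter> F n)) / real (card (F n))
      \<le> (\<Sum>i\<in>I. real (card (A i \<inter> F n)) / real (card (F n)))" for n
  proof -
    have "card ((\<Union>i\<in>I. A i) \<inter> F n) \<le> (\<Sum>i\<in>I. card (A i \<inter> F n))"
      using card_UN_le[OF assms(1), of "\<lambda>i. A i \<inter> F n"] by simp
    then have "real (card ((\<Union>i\<in>I. A i) \<inter> F n)) \<le> (\<Sum>i\<in>I. real (card (A i \<inter> F n)))"
      by (metis of_nat_le_iff of_nat_sum)
    then show ?thesis
      unfolding sum_divide_distrib[symmetric] by (rule divide_right_mono) simp
  qed
  then show "\<forall>\<^sub>F n in net_filter D r. real (card ((\<Union>i\<in>I. A i) \<inter> F n)) / real (card (F n))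
      \<le> (\<Sum>i\<in>I. real (card (A i \<inter> F n)) / real (card (F n)))" by simp
qed

section \<open>Translates of a set of positive upper density\<close>

text \<open>A point of \<open>A\<close> in \<open>F n\<close> either lies in the translate of
  \<open>F n\<close> by the inverse of \<open>k\<close>, and then multiplication by \<open>k\<close>
  moves it into the right-hand intersection, or it is counted by the symmetric difference.\<close>

lemma card_translate_Int_ge:
  assumes "group G" "A \<subseteq> carrier G" "k \<in> carrier G" "n \<in> D"
  shows "card (A \<inter> F n)
    \<le> card ((k <#\<^bsub>G\<^esub> A) \<inter> F n) + card (sym_diff (inv\<^bsub>G\<^esub> k <#\<^bsub>G\<^esub> F n) (F n))"
proof -
  interpret group G by fact
  let ?F' = "inv\<^bsub>G\<^esub> k <#\<^bsub>G\<^esub> F n"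
  have Fn: "F n \<subseteq> carrier G" "finite (F n)" using folner_sets assms(4) by auto
  have F'_eq: "?F' = (\<lambda>f. inv\<^bsub>G\<^esub> k \<otimes>\<^bsub>G\<^esub> f) ` F n" unfolding l_coset_def by auto
  then have fin: "finite ?F'" using Fn by simp
  have "A \<inter> F n \<subseteq> (A \<inter> ?F') \<union> sym_diff ?F' (F n)" by auto
  then have "card (A \<inter> F n) \<le> card ((A \<inter> ?F') \<union> sym_diff ?F' (F n))"
    using fin Fn by (intro card_mono) auto
  also have "\<dots> \<le> card (A \<inter> ?F') + card (sym_diff ?F' (F n))" by (rule card_Un_le)
  also have "card (A \<inter> ?F') \<le> card ((k <#\<^bsub>G\<^esub> A) \<inter> F n)"
  proof (rule card_inj_on_le)
    show "inj_on (\<lambda>a. k \<otimes>\<^bsub>G\<^esub> a) (A \<inter> ?F')"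
      using assms(2,3) by (auto intro!: inj_onI simp: subset_iff)
    show "(\<lambda>a. k \<otimes>\<^bsub>G\<^esub> a) ` (A \<inter> ?F') \<subseteq> (k <#\<^bsub>G\<^esub> A) \<inter> F n"
    proof
      fix u assume "u \<in> (\<lambda>a. k \<otimes>\<^bsub>G\<^esub> a) ` (A \<inter> ?F')"
      then obtain a where a: "a \<in> A" "a \<in> ?F'" "u = k \<otimes>\<^bsub>G\<^esub> a" by blast
      have "u \<in> k <#\<^bsub>G\<^esub> A" using a unfolding l_coset_def by auto
      moreover obtain f where "f \<in> F n" "a = inv\<^bsub>G\<^esub> k \<otimes>\<^bsub>G\<^esub> f" using a F'_eq by auto
      then have "u \<in> F n"
        using a(3) Fn assms(3) by (auto simp: m_assoc[symmetric] subset_iff)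
      ultimately show "u \<in> (k <#\<^bsub>G\<^esub> A) \<inter> F n" by blast
    qed
    show "finite ((k <#\<^bsub>G\<^esub> A) \<inter> F n)" using Fn by simp
  qed
  finally show ?thesis by simp
qed

text \<open>The frequent bound stands in for a subnet: it can be combined with finitely many
  eventual conditions.\<close>

lemma not_negligible_along_obtain_frequently:
  assumes "\<not> negligible_along D r F A"
  obtains \<alpha> where "\<alpha> > 0"
    "\<exists>\<^sub>F n in net_filter D r. real (card (A \<inter> F n)) \<ge> \<alpha> * real (card (F n))"
proof -
  obtain \<alpha> where a: "\<alpha> > 0" and
    "\<not> eventually (\<lambda>n. dist (real (card (A \<inter> F n)) / real (card (F n))) 0 < \<alpha>) (net_filter D r)"
    using assms unfolding negligible_along_def tendsto_iff by blast
  then have "\<exists>\<^sub>F n in net_filter D r. \<alpha> \<le> real (card (A \<inter> F n)) / real (card (F n))"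
    by (simp add: frequently_def not_le dist_real_def)
  then have "\<exists>\<^sub>F n in net_filter D r. real (card (A \<inter> F n)) \<ge> \<alpha> * real (card (F n))"
  proof (rule frequently_rev_mp)
    show "\<forall>\<^sub>F n in net_filter D r. \<alpha> \<le> real (card (A \<inter> F n)) / real (card (F n)) \<longrightarrow>
        real (card (A \<inter> F n)) \<ge> \<alpha> * real (card (F n))"
      using eventually_in_index
      by eventually_elim (use folner_sets(3) in \<open>auto simp: field_simps\<close>)
  qed
  with a that show thesis by blast
qed

text \<open>At a single index where \<open>A\<close> has frequency at least \<alpha> and
  \<open>F n\<close> is almost invariant for all of \<open>K\<close>, each translate fills at least
  \<alpha>/2 of \<open>F n\<close>, the other half being lost to the invariance error. Disjoint
  translates cannot overfill \<open>F n\<close>.\<close>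

lemma card_disjoint_translates_le:
  assumes "group G" "A \<subseteq> carrier G" and \<alpha>: "\<alpha> > 0"
    and freq: "\<exists>\<^sub>F n in net_filter D r. real (card (A \<inter> F n)) \<ge> \<alpha> * real (card (F n))"
    and K: "finite K" "K \<subseteq> carrier G"
    and disj: "\<And>k l. k \<in> K \<Longrightarrow> l \<in> K \<Longrightarrow> k \<noteq> l \<Longrightarrow> (k <#\<^bsub>G\<^esub> A) \<inter> (l <#\<^bsub>G\<^esub> A) = {}"
  shows "real (card K) \<le> 2 / \<alpha>"
proof -
  interpret group G by fact
  let ?s = "\<lambda>k n. card (sym_diff (inv\<^bsub>G\<^esub> k <#\<^bsub>G\<^esub> F n) (F n))"
  have "\<forall>\<^sub>F n in net_filter D r. real (?s k n) / real (card (F n)) < \<alpha> / 2" if "k \<in> K" for k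
  proof -
    have "inv\<^bsub>G\<^esub> k \<in> carrier G" using that K by auto
    then have "((\<lambda>n. real (?s k n) / real (card (F n))) \<longlongrightarrow> 0) (net_filter D r)"
      using folner unfolding folner_net_def by blast
    then show ?thesis using \<alpha> by (intro order_tendstoD) auto
  qed
  then have "\<forall>\<^sub>F n in net_filter D r. n \<in> D \<and>
      (\<forall>k\<in>K. real (?s k n) / real (card (F n)) < \<alpha> / 2)"
    using K(1) by (intro eventually_conj eventually_in_index) (simp add: eventually_ball_finite)
  with freq have "\<exists>\<^sub>F n in net_filter D r. real (card (A \<inter> F n)) \<ge> \<alpha> * real (card (F n)) \<and>
      (n \<in> D \<and> (\<forall>k\<in>K. real (?s k n) / real (card (F n)) < \<alpha> / 2))"
    by (rule frequently_eventually_frequently)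
  then obtain n where n: "n \<in> D" and An: "real (card (A \<inter> F n)) \<ge> \<alpha> * real (card (F n))"
    and s: "\<And>k. k \<in> K \<Longrightarrow> real (?s k n) / real (card (F n)) < \<alpha> / 2"
    by (blast dest: frequently_ex)
  note Fn = folner_sets[OF n]
  have ge: "\<alpha> / 2 * real (card (F n)) \<le> real (card ((k <#\<^bsub>G\<^esub> A) \<inter> F n))" if "k \<in> K" for k
  proof -
    have "real (?s k n) < \<alpha> / 2 * real (card (F n))" using s[OF that] Fn(3) by (simp add: field_simps)
    moreover have "real (card (A \<inter> F n)) \<le> real (card ((k <#\<^bsub>G\<^esub> A) \<inter> F n)) + real (?s k n)"
      using card_translate_Int_ge[OF assms(1,2) _ n, of k] that K
      by (metis of_nat_add of_nat_le_iff subsetD)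
    ultimately show ?thesis using An by linarith
  qed
  have "real (card K) * (\<alpha> / 2 * real (card (F n))) \<le> (\<Sum>k\<in>K. real (card ((k <#\<^bsub>G\<^esub> A) \<inter> F n)))"
    using ge by (rule sum_bounded_below)
  also have "\<dots> = real (card (\<Union>k\<in>K. (k <#\<^bsub>G\<^esub> A) \<inter> F n))"
    using disj K(1) Fn(2) by (subst card_UN_disjoint) auto
  also have "\<dots> \<le> real (card (F n))" using Fn(2) by (intro of_nat_mono card_mono) auto
  finally have "real (card K) * (\<alpha> / 2) * real (card (F n)) \<le> 1 * real (card (F n))"
    by (simp add: mult.assoc)
  then have "real (card K) * (\<alpha> / 2) \<le> 1" using Fn(3) by simp
  then show ?thesis using \<alpha> by (simp add: field_simps)
qed

text \<open>For a largest \<open>K\<close> with pairwise disjoint translates, any further translate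
  of \<open>A\<close> must meet one of them. The conclusion says that \<open>K A A^-1\<close> is the
  whole group, written without inverses.\<close>

lemma not_negligible_along_difference_syndetic:
  assumes "group G" "A \<subseteq> carrier G" "\<not> negligible_along D r F A"
  obtains K where "finite K" "K \<subseteq> carrier G"
    "\<And>g. g \<in> carrier G \<Longrightarrow> \<exists>k\<in>K. \<exists>a\<in>A. \<exists>b\<in>A. g \<otimes>\<^bsub>G\<^esub> b = k \<otimes>\<^bsub>G\<^esub> a"
proof -
  define P where "P K \<longleftrightarrow> finite K \<and> K \<subseteq> carrier G \<and>
    (\<forall>k\<in>K. \<forall>l\<in>K. k \<noteq> l \<longrightarrow> (k <#\<^bsub>G\<^esub> A) \<inter> (l <#\<^bsub>G\<^esub> A) = {})" for K
  obtain \<alpha> where \<alpha>: "\<alpha> > 0"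
    "\<exists>\<^sub>F n in net_filter D r. real (card (A \<inter> F n)) \<ge> \<alpha> * real (card (F n))"
    using assms(3) not_negligible_along_obtain_frequently by metis
  have "card K \<le> nat \<lfloor>2 / \<alpha>\<rfloor>" if "P K" for K
    using card_disjoint_translates_le[OF assms(1,2) \<alpha>, of K] that unfolding P_def
    by (auto intro: le_nat_floor)
  moreover have "P {}" unfolding P_def by simp
  ultimately obtain K where K: "P K" and max: "\<And>K'. P K' \<Longrightarrow> card K' \<le> card K"
    using ex_has_greatest_nat[of P "{}" card "Suc (nat \<lfloor>2 / \<alpha>\<rfloor>)"]
    by (metis less_Suc_eq_le)
  show thesis
  proof (rule that)
    show fin: "finite K" and "K \<subseteq> carrier G" using K unfolding P_def by auto
    fix g assume g: "g \<in> carrier G"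
    obtain a where a: "a \<in> A" using assms(3) negligible_along_empty by (metis ex_in_conv)
    show "\<exists>k\<in>K. \<exists>a\<in>A. \<exists>b\<in>A. g \<otimes>\<^bsub>G\<^esub> b = k \<otimes>\<^bsub>G\<^esub> a"
    proof (cases "g \<in> K")
      case True
      then show ?thesis using a by blast
    next
      case False
      then have "\<not> P (insert g K)" using max[of "insert g K"] fin by auto
      then obtain k where "k \<in> K" "(g <#\<^bsub>G\<^esub> A) \<inter> (k <#\<^bsub>G\<^esub> A) \<noteq> {}"
        using K g unfolding P_def by blast
      then show ?thesis unfolding l_coset_def by blast
    qed
  qed
qed

end

section \<open>The minimal center of attraction\<close>

context G_system
begin

lemma action_closed: "g \<in> carrier G \<Longrightarrow> x \<in> X \<Longrightarrow> \<phi> g x \<in> X"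
  using element_image by blast

lemma action_inv_cancel: "g \<in> carrier G \<Longrightarrow> x \<in> X \<Longrightarrow> \<phi> (inv g) (\<phi> g x) = x"
  using orbit_sym_aux by blast

lemma is_group: "group G"
  using group_hom group_hom.axioms(1) by blast

text \<open>The minimal center is in fact the least center, so the description operator in
  \<^const>\<open>minimal_center\<close> is well defined.\<close>

lemma minimal_center_eq:
  assumes folner: "folner_net G D r F" and x: "x \<in> X"
  shows "minimal_center G X \<phi> D r F x =
    {y\<in>X. \<forall>e>0. \<not> negligible_along D r F {g\<in>carrier G. dist (\<phi> g x) y < e}}"
proof -
  define N where "N U \<longleftrightarrow> negligible_along D r F {g\<in>carrier G. \<phi> g x \<in> U}" for U
  \<comment> \<open>The candidate for the least center: each point of \<open>X\<close> outside it
    has a ball with negligible visit times.\<close>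
  define C where "C = {y\<in>X. \<forall>e>0. \<not> N (ball y e)}"
  note subset = negligible_along_subset[OF folner]
  have center_iff: "center_of_attraction G X \<phi> D r F x B \<longleftrightarrow>
      closedin (top_of_set X) B \<and> (\<forall>e>0. N (X - nbhd X e B))" for B
  proof -
    have "carrier G - {g \<in> carrier G. \<phi> g x \<in> nbhd X e B} =
        {g \<in> carrier G. \<phi> g x \<in> X - nbhd X e B}" for e
      using action_closed[OF _ x] by auto
    then show ?thesis
      unfolding center_of_attraction_def N_def
      by (simp add: has_density_1_iff[OF folner])
  qed
  have clC: "closedin (top_of_set X) C"
  proof -
    have "openin (top_of_set X) (X - C)"
      unfolding openin_euclidean_subtopology_iff
    proof (intro conjI ballI)
      fix y assume "y \<in> X - C"
      then obtain e where e: "e > 0" "N (ball y e)" unfolding C_def by auto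
      have "y' \<in> X - C" if y': "y' \<in> X" "dist y' y < e / 2" for y'
      proof -
        have "ball y' (e / 2) \<subseteq> ball y e"
        proof
          fix u assume "u \<in> ball y' (e / 2)"
          then show "u \<in> ball y e"
            using y'(2) dist_triangle[of y u y'] by (simp add: dist_commute)
        qed
        then have "N (ball y' (e / 2))"
          using e(2) unfolding N_def by (elim subset) blast
        then show ?thesis using y' half_gt_zero[OF e(1)] unfolding C_def by blast
      qed
      then show "\<exists>e>0. \<forall>x'\<in>X. dist x' y < e \<longrightarrow> x' \<in> X - C"
        using e(1) half_gt_zero by blast
    qed auto
    moreover have "C \<subseteq> X" unfolding C_def by auto
    ultimately show ?thesis by (simp add: closedin_def)
  qed
  have center: "center_of_attraction G X \<phi> D r F x C"
    unfolding center_iff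
  proof (intro conjI clC allI impI)
    fix e :: real assume e: "e > 0"
    have eq: "X - nbhd X e C = X - (\<Union>c\<in>C. ball c e)"
      unfolding nbhd_def by (auto simp: dist_commute)
    \<comment> \<open>Compactness reduces the cover of the remainder by negligible balls to a finite
      one, and finite unions of negligible sets are negligible.\<close>
    have cpt: "compact (X - nbhd X e C)"
      unfolding eq using compact_space by (intro compact_diff open_UN) auto
    obtain \<U> where \<U>: "\<U> \<subseteq> {ball y d | y d. y \<in> X \<and> d > 0 \<and> N (ball y d)}" "finite \<U>"
      "X - nbhd X e C \<subseteq> \<Union>\<U>"
    proof (rule compactE[OF cpt, of "{ball y d | y d. y \<in> X \<and> d > 0 \<and> N (ball y d)}"])
      show "X - nbhd X e C \<subseteq> \<Union>{ball y d | y d. y \<in> X \<and> d > 0 \<and> N (ball y d)}"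
      proof
        fix y assume y: "y \<in> X - nbhd X e C"
        then have "y \<in> X - C" using e unfolding nbhd_def by auto
        then obtain d where "d > 0" "N (ball y d)" "y \<in> X" unfolding C_def by auto
        then show "y \<in> \<Union>{ball y d | y d. y \<in> X \<and> d > 0 \<and> N (ball y d)}"
          using centre_in_ball by blast
      qed
    qed auto
    have "negligible_along D r F (\<Union>U\<in>\<U>. {g\<in>carrier G. \<phi> g x \<in> U})"
      using \<U>(1) unfolding N_def by (intro negligible_along_UN[OF folner \<U>(2)]) auto
    then show "N (X - nbhd X e C)"
      unfolding N_def by (rule subset) (use \<U>(3) in blast)
  qed
  have least: "C \<subseteq> B" if B: "center_of_attraction G X \<phi> D r F x B" for B
  proof
    fix y assume y: "y \<in> C"
    then have yX: "y \<in> X" unfolding C_def by auto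
    show "y \<in> B"
    proof (rule ccontr)
      assume "y \<notin> B"
      moreover have "openin (top_of_set X) (X - B)" using B unfolding center_iff by auto
      ultimately obtain e where e: "e > 0" and eB: "\<And>z. z \<in> X \<Longrightarrow> dist z y < e \<Longrightarrow> z \<notin> B"
        using yX unfolding openin_euclidean_subtopology_iff by (metis Diff_iff)
      \<comment> \<open>The radius is split evenly: within \<open>e / 2\<close> of \<open>y\<close>,
        no point is within \<open>e / 2\<close> of \<open>B\<close>, so a ball around
        \<open>y\<close> would be visited negligibly.\<close>
      have "N (X - nbhd X (e / 2) B)" using B e unfolding center_iff by simp
      moreover have "z \<in> X - nbhd X (e / 2) B" if z: "z \<in> X" "z \<in> ball y (e / 2)" for z
      proof -
        have "\<not> dist z c < e / 2" if c: "c \<in> B" for c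
        proof
          assume "dist z c < e / 2"
          then have "dist c y < e" using z(2)
            by (metis dist_commute dist_triangle_half_l mem_ball)
          moreover have "c \<in> X" using B c unfolding center_iff by (auto dest: closedin_imp_subset)
          ultimately show False using eB c by blast
        qed
        then show ?thesis using z unfolding nbhd_def by auto
      qed
      ultimately have "N (ball y (e / 2))"
        unfolding N_def using action_closed[OF _ x] by (elim subset) blast
      then show False using y e half_gt_zero unfolding C_def by blast
    qed
  qed
  have "minimal_center G X \<phi> D r F x = C"
    unfolding minimal_center_def
  proof (rule the_equality)
    show "center_of_attraction G X \<phi> D r F x C \<and>
        (\<forall>C'. C' \<subset> C \<longrightarrow> \<not> center_of_attraction G X \<phi> D r F x C')"
      using center least by blast
  qed (use center least in blast)
  then show ?thesis unfolding C_def N_def by (simp add: dist_commute)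
qed

section \<open>Sensitivity\<close>

lemma sensitive:
  assumes folner: "folner_net G D r F" and x: "x \<in> X"
    and visits: "\<And>y e. y \<in> X \<Longrightarrow> e > 0 \<Longrightarrow>
      \<not> negligible_along D r F {g\<in>carrier G. dist (\<phi> g x) y < e}"
    and z: "z \<in> X" and w: "w \<in> X" and \<delta>: "\<delta> > 0"
    and far: "\<And>g. g \<in> carrier G \<Longrightarrow> 4 * \<delta> \<le> dist (\<phi> g z) w"
    and y: "y \<in> X" and e: "e > 0"
  shows "\<exists>p\<in>X. \<exists>q\<in>X. \<exists>g\<in>carrier G. dist p y < e \<and> dist q y < e \<and> \<delta> < dist (\<phi> g p) (\<phi> g q)"
proof (rule ccontr)
  assume "\<not> ?thesis"
  then have stable: "dist (\<phi> g p) (\<phi> g q) \<le> \<delta>"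
    if "p \<in> X" "q \<in> X" "g \<in> carrier G" "dist p y < e" "dist q y < e" for p q g
    using that by (meson not_le)
  interpret group G by (rule is_group)
  have visit: "\<exists>g\<in>carrier G. dist (\<phi> g x) u < d" if "u \<in> X" "d > 0" for u d
    using visits[OF that] negligible_along_empty[OF folner]
    by (metis (mono_tags, lifting) empty_Collect_eq)
  obtain h where h: "h \<in> carrier G" "dist (\<phi> h x) y < e" using visit[OF y e] by blast
  obtain t where t: "t \<in> carrier G" "dist (\<phi> t x) w < \<delta>" using visit[OF w \<delta>] by blast
  \<comment> \<open>\<open>c\<close> carries \<open>x'\<close>, which is near \<open>w\<close>, to
    the point \<open>h x\<close> of the ball around \<open>y\<close>. Pulling that ball back along
    \<open>c\<close> gives a neighborhood of \<open>x'\<close>.\<close>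
  define c where "c = h \<otimes> inv t"
  define x' where "x' = \<phi> t x"
  have c: "c \<in> carrier G" unfolding c_def using h t by simp
  have x': "x' \<in> X" unfolding x'_def using action_closed t x by blast
  have ct: "c \<otimes> t = h" unfolding c_def using h t by (simp add: m_assoc)
  have cx': "dist (\<phi> c x') y < e"
    using composition_rule[OF x c t(1)] h(2) unfolding ct x'_def by simp
  \<comment> \<open>The bound survives the pullback because \<open>g\<close> is
    \<open>g \<otimes> inv c\<close> after \<open>c\<close>, and \<open>g \<otimes> inv c\<close> is
    again a group element.\<close>
  have stable': "dist (\<phi> g p) (\<phi> g q) \<le> \<delta>"
    if p: "p \<in> X" "dist (\<phi> c p) y < e" and q: "q \<in> X" "dist (\<phi> c q) y < e"
      and g: "g \<in> carrier G" for p q g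
  proof -
    have "\<phi> (g \<otimes> inv c) (\<phi> c u) = \<phi> g u" if "u \<in> X" for u
      using composition_rule[of "\<phi> c u" g "inv c"] g c that
      by (simp add: action_closed action_inv_cancel)
    then show ?thesis
      using stable[of "\<phi> c p" "\<phi> c q" "g \<otimes> inv c"] p q g c by (simp add: action_closed)
  qed
  obtain d1 where d1: "d1 > 0" "\<And>p. p \<in> X \<Longrightarrow> dist p x' < d1 \<Longrightarrow> dist (\<phi> c p) (\<phi> c x') < e - dist (\<phi> c x') y"
    using continuous_action[OF c] x' cx' unfolding continuous_on_iff
    by (metis diff_gt_0_iff_gt)
  have near: "dist (\<phi> c p) y < e" if "p \<in> X" "dist p x' < d1" for p
    using d1(2)[OF that] dist_triangle[of "\<phi> c p" y "\<phi> c x'"] by linarith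
  \<comment> \<open>The radius \<open>d1\<close> keeps visits in the pulled-back ball, and \<delta>
    keeps them close to \<open>x'\<close>.\<close>
  define A where "A = {g\<in>carrier G. dist (\<phi> g x) x' < min d1 \<delta>}"
  have "\<not> negligible_along D r F A" unfolding A_def using x' d1(1) \<delta> by (intro visits) auto
  moreover have A_sub: "A \<subseteq> carrier G" unfolding A_def by auto
  ultimately obtain K where K: "finite K" "K \<subseteq> carrier G"
    and cover: "\<And>g. g \<in> carrier G \<Longrightarrow> \<exists>k\<in>K. \<exists>a\<in>A. \<exists>b\<in>A. g \<otimes> b = k \<otimes> a"
    using not_negligible_along_difference_syndetic[OF folner is_group] by metis
  \<comment> \<open>One modulus of continuity at \<open>z\<close> for all the finitely many maps
    \<open>inv k\<close>.\<close>
  have "\<exists>d>0. \<forall>v\<in>X. dist v z < d \<longrightarrow> (\<forall>k\<in>K. dist (\<phi> (inv k) v) (\<phi> (inv k) z) < \<delta>)"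
    using K
  proof (induction K rule: finite_induct)
    case empty
    then show ?case by (auto intro: exI[of _ 1])
  next
    case (insert k K)
    then obtain a where a: "a > 0"
      "\<forall>v\<in>X. dist v z < a \<longrightarrow> (\<forall>k\<in>K. dist (\<phi> (inv k) v) (\<phi> (inv k) z) < \<delta>)" by auto
    have "inv k \<in> carrier G" using insert.prems by auto
    then obtain b where b: "b > 0"
      "\<forall>v\<in>X. dist v z < b \<longrightarrow> dist (\<phi> (inv k) v) (\<phi> (inv k) z) < \<delta>"
      using continuous_action[of "inv k"] z \<delta> unfolding continuous_on_iff by metis
    show ?case using a b by (intro exI[of _ "min a b"]) auto
  qed
  then obtain d where d: "d > 0"
    "\<And>v k. v \<in> X \<Longrightarrow> dist v z < d \<Longrightarrow> k \<in> K \<Longrightarrow> dist (\<phi> (inv k) v) (\<phi> (inv k) z) < \<delta>"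
    by blast
  obtain g0 where g0: "g0 \<in> carrier G" "dist (\<phi> g0 x) z < d" using visit[OF z d(1)] by blast
  \<comment> \<open>\<open>g\<close> takes \<open>x'\<close> to \<open>g0 x\<close>, which is close
    to \<open>z\<close>.\<close>
  define g where "g = g0 \<otimes> inv t"
  have g: "g \<in> carrier G" unfolding g_def using g0 t by simp
  obtain k a b where kab: "k \<in> K" "a \<in> A" "b \<in> A" "g \<otimes> b = k \<otimes> a" using cover[OF g] by blast
  have mem: "k \<in> carrier G" "a \<in> carrier G" "b \<in> carrier G" using kab A_sub K by auto
  \<comment> \<open>\<open>s\<close> equals \<open>a \<otimes> inv b\<close>, so it sends
    \<open>b x\<close> to \<open>a x\<close>, both near \<open>x'\<close>; yet it sends
    \<open>x'\<close> to a point near \<open>inv k z\<close>, far from \<open>w\<close>.\<close>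
  define s where "s = inv k \<otimes> g"
  have s: "s \<in> carrier G" unfolding s_def using g mem by simp
  have sb: "s \<otimes> b = a"
    unfolding s_def using g mem kab(4) by (simp add: m_assoc) (simp add: m_assoc[symmetric])
  have st: "s \<otimes> t = inv k \<otimes> g0"
    unfolding s_def g_def using g0 t mem by (simp add: m_assoc)
  have s_bx: "\<phi> s (\<phi> b x) = \<phi> a x"
    using composition_rule[OF x s mem(3)] unfolding sb by simp
  have s_x': "\<phi> s x' = \<phi> (inv k) (\<phi> g0 x)"
    using composition_rule[OF x s t(1)] composition_rule[OF x _ g0(1), of "inv k"] mem
    unfolding st x'_def by simp
  have "dist (\<phi> s x') (\<phi> s (\<phi> b x)) \<le> \<delta>"
  proof (rule stable'[OF x' cx' _ _ s])
    show bx: "\<phi> b x \<in> X" using action_closed mem x by blast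
    show "dist (\<phi> c (\<phi> b x)) y < e" using near[OF bx] kab(3) unfolding A_def by simp
  qed
  then have 1: "dist (\<phi> s x') (\<phi> a x) \<le> \<delta>" unfolding s_bx .
  have 2: "dist (\<phi> a x) x' < \<delta>" using kab(2) unfolding A_def by simp
  have 3: "dist x' w < \<delta>" unfolding x'_def by (rule t(2))
  have 4: "dist (\<phi> s x') (\<phi> (inv k) z) < \<delta>"
    unfolding s_x' using d(2)[OF action_closed[OF g0(1) x] g0(2) kab(1)] .
  \<comment> \<open>The chain from \<open>inv k z\<close> through \<open>s x'\<close>,
    \<open>a x\<close> and \<open>x'\<close> to \<open>w\<close> has four links of size at most
    \<delta>, three of them strictly smaller; hence the factor 4 in \<open>far\<close>.\<close>
  have "dist (\<phi> (inv k) z) w < 4 * \<delta>"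
    using 1 2 3 4 dist_triangle3[of "\<phi> (inv k) z" w "\<phi> s x'"] dist_triangle[of "\<phi> s x'" w "\<phi> a x"]
      dist_triangle[of "\<phi> a x" w x'] by linarith
  then show False using far[of "inv k"] mem by simp
qed

end

theorem theorem1p4:
  fixes G :: "('g, 'b) monoid_scheme"
    and X :: "'x::metric_space set"
    and \<phi> :: "'g \<Rightarrow> 'x \<Rightarrow> 'x"
    and D :: "'d set" and r :: "'d rel"
    and F :: "'d \<Rightarrow> 'g set"
  assumes "G_system G X \<phi>"
    and "folner_net G D r F"
    and "S_generic G X \<phi> D r F"
    and "\<not> minimal_system G X \<phi>"
  shows "point_transitive G X \<phi> \<and>
    (\<exists>\<epsilon>>0. \<forall>xhat\<in>X. \<exists>S. dense_in X S \<and>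
       (\<forall>y\<in>S. \<exists>t :: nat \<Rightarrow> 'g. (\<forall>n. t n \<in> carrier G) \<and>
          (\<exists>L\<ge>\<epsilon>. (\<lambda>n. dist (\<phi> (t n) xhat) (\<phi> (t n) y)) \<longlonglongrightarrow> L)))"
proof -
  interpret G_system G X \<phi> by fact
  note folner = assms(2)
  have orbit_sub: "orbit G \<phi> u \<subseteq> X" if "u \<in> X" for u
    using action_closed that unfolding orbit_def by auto
  obtain x where x: "x \<in> X" and "minimal_center G X \<phi> D r F x = X"
    using assms(3) unfolding S_generic_def by blast
  then have visits: "\<not> negligible_along D r F {g\<in>carrier G. dist (\<phi> g x) y < e}"
    if "y \<in> X" "e > 0" for y e
    using that unfolding minimal_center_eq[OF folner x] by blast
  have "\<exists>o'\<in>orbit G \<phi> x. dist o' y < e" if ye: "y \<in> X" "e > 0" for y e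
  proof -
    have "{g\<in>carrier G. dist (\<phi> g x) y < e} \<noteq> {}"
      using visits[OF ye] negligible_along_empty[OF folner] by metis
    then show ?thesis unfolding orbit_def by blast
  qed
  then have "point_transitive G X \<phi>"
    unfolding point_transitive_def dense_in_def closure_approachable
    using x orbit_sub[OF x] by (intro bexI[of _ x]) (auto simp: closure_approachable)
  moreover
  \<comment> \<open>Failure of minimality supplies an orbit whose closure misses a point
    \<open>w\<close>.\<close>
  obtain z w where z: "z \<in> X" and w: "w \<in> X" and "w \<notin> closure (orbit G \<phi> z)"
    using assms(4) orbit_sub unfolding minimal_system_def dense_in_def by blast
  then obtain e0 where e0: "e0 > 0" "\<And>u. u \<in> orbit G \<phi> z \<Longrightarrow> e0 \<le> dist u w"
    unfolding closure_approachable by (meson not_le)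
  define \<delta> where "\<delta> = e0 / 4"
  have \<delta>: "\<delta> > 0" and far: "\<And>g. g \<in> carrier G \<Longrightarrow> 4 * \<delta> \<le> dist (\<phi> g z) w"
    using e0 unfolding \<delta>_def orbit_def by auto
  have "\<exists>S. dense_in X S \<and> (\<forall>y\<in>S. \<exists>t :: nat \<Rightarrow> 'g. (\<forall>n. t n \<in> carrier G) \<and>
      (\<exists>L\<ge>\<delta> / 2. (\<lambda>n. dist (\<phi> (t n) xhat) (\<phi> (t n) y)) \<longlonglongrightarrow> L))" for xhat
  proof -
    let ?S = "{y\<in>X. \<exists>g\<in>carrier G. \<delta> / 2 \<le> dist (\<phi> g xhat) (\<phi> g y)}"
    have "\<exists>u\<in>?S. dist u y < e" if ye: "y \<in> X" "e > 0" for y e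
    proof -
      obtain p q g where pq: "p \<in> X" "q \<in> X" "g \<in> carrier G" "dist p y < e" "dist q y < e"
        "\<delta> < dist (\<phi> g p) (\<phi> g q)"
        using sensitive[OF folner x visits z w \<delta> far ye] by blast
      \<comment> \<open>\<open>g xhat\<close> cannot be within \<delta>/2 of both \<open>g p\<close>
        and \<open>g q\<close>, so one of \<open>p\<close> and \<open>q\<close> belongs to
        \<open>?S\<close>; this is where half of \<delta> is lost.\<close>
      then have "\<delta> / 2 \<le> dist (\<phi> g xhat) (\<phi> g p) \<or> \<delta> / 2 \<le> dist (\<phi> g xhat) (\<phi> g q)"
        using dist_triangle3[of "\<phi> g p" "\<phi> g q" "\<phi> g xhat"] by linarith
      then show ?thesis using pq by blast
    qed
    then have "dense_in X ?S" unfolding dense_in_def by (auto simp: closure_approachable)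
    moreover have "\<exists>t :: nat \<Rightarrow> 'g. (\<forall>n. t n \<in> carrier G) \<and>
        (\<exists>L\<ge>\<delta> / 2. (\<lambda>n. dist (\<phi> (t n) xhat) (\<phi> (t n) y)) \<longlonglongrightarrow> L)" if y: "y \<in> ?S" for y
    proof -
      obtain g where "g \<in> carrier G" "\<delta> / 2 \<le> dist (\<phi> g xhat) (\<phi> g y)" using y by auto
      then show ?thesis by (intro exI[of _ "\<lambda>_. g"]) auto
    qed
    ultimately show ?thesis by blast
  qed
  ultimately show ?thesis using half_gt_zero[OF \<delta>] by blast
qed

end
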